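(* Let $\mathcal{T}$ be a triangulated category with suspension functor $\Sigma$ and let $\mathcal{A}$ be an abelian subcategory of $\mathcal{T}$ such that $\mathcal{T}(\mathcal{A},\Sigma^{-1}\mathcal{A})=0$. Then the following hold: (1) The inclusion $\mathcal{A}\to\mathcal{A}*\Sigma\mathcal{A}$ admits $\mathrm{C}_{\mathcal{T}}$ as a left adjoint, with the unit given by $\eta$. (2) The inclusion $\mathcal{A}\to\Sigma^{-1}\mathcal{A}*\mathcal{A}$ admits $\mathrm{K}_{\mathcal{T}}$ as a right adjoint, with the counit given by $\varepsilon$.
   Context: Conventions: subcategories are full and closed under isomorphisms; an abelian subcategory of $\mathcal{T}$ is an additive subcategory (full, with additive inclusion) which is an abelian category. The condition $\mathcal{T}(\mathcal{A},\Sigma^{-1}\mathcal{A})=0$ means $\mathrm{Hom}_{\mathcal{T}}(a,\Sigma^{-1}a')=0$ for all $a,a'$ in $\mathcal{A}$. For additive subcategories $\mathcal{X},\mathcal{Z}$ of $\mathcal{T}$, $\mathcal{X}*\mathcal{Z}$ is the full subcategory of objects $t$ for which there exists a distinguished triangle $x\to t\to z\to\Sigma x$ with $x$ in $\mathcal{X}$, $z$ in $\mathcal{Z}$. One has $\mathcal{A}\subseteq\mathcal{A}*\Sigma\mathcal{A}$ and $\mathcal{A}\subseteq\Sigma^{-1}\mathcal{A}*\mathcal{A}$. Fixed choices: kernels and cokernels in $\mathcal{A}$ of all morphisms of $\mathcal{A}$; for each $z$ in $\mathcal{A}*\Sigma\mathcal{A}$ a distinguished triangle $a_z\xrightarrow{f_z}b_z\to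 z\to\Sigma(a_z)$ with $a_z,b_z$ in $\mathcal{A}$; for each $x$ in $\Sigma^{-1}\mathcal{A}*\mathcal{A}$ a distinguished triangle $\Sigma^{-1}(d_x)\to x\to c_x\xrightarrow{g_x}d_x$ with $c_x,d_x$ in $\mathcal{A}$; for each such $z$ a morphism $\eta_z\colon z\to\mathrm{coker}(f_z)$ whose composite with $b_z\to z$ is the canonical morphism $b_z\to\mathrm{coker}(f_z)$; for each such $x$ a morphism $\varepsilon_x\colon\ker(g_x)\to x$ whose composite with $x\to c_x$ is the canonical morphism $\ker(g_x)\to c_x$. The functor $\mathrm{C}_{\mathcal{T}}\colon\mathcal{A}*\Sigma\mathcal{A}\to\mathcal{A}$ is given by $\mathrm{C}_{\mathcal{T}}(z)=\mathrm{coker}(f_z)$ and, for $w\colon z\to z'$, $\mathrm{C}_{\mathcal{T}}(w)$ is the unique morphism with $\mathrm{C}_{\mathcal{T}}(w)\eta_z=\eta_{z'}w$. Dually, $\mathrm{K}_{\mathcal{T}}\colon\Sigma^{-1}\mathcal{A}*\mathcal{A}\to\mathcal{A}$ is given by $\mathrm{K}_{\mathcal{T}}(x)=\ker(g_x)$ and, for $w\colon x\to x'$, $\mathrm{K}_{\mathcal{T}}(w)$ is the unique morphism with $\varepsilon_{x'}\mathrm{K}_{\mathcal{T}}(w)=w\varepsilon_x$. (Under the hypothesis of the statement these morphisms exist, are unique, and define functors.) *)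

theory Defs
  imports "HOL-Algebra.Group"
begin

section \<open>Categories and functors\<close>

record ('o, 'm) cat =
  Obj :: "'o set"
  Arr :: "'m set"
  Dom :: "'m \<Rightarrow> 'o"
  Cod :: "'m \<Rightarrow> 'o"
  Id :: "'o \<Rightarrow> 'm"
  Comp :: "'m \<Rightarrow> 'm \<Rightarrow> 'm"  (infixl "\<cdot>\<index>" 70)

definition Hom :: "('o, 'm, 'x) cat_scheme \<Rightarrow> 'o \<Rightarrow> 'o \<Rightarrow> 'm set"
  where "Hom C a b = {f \<in> Arr C. Dom C f = a \<and> Cod C f = b}"

locale category =
  fixes C :: "('o, 'm, 'x) cat_scheme" (structure)
  assumes Dom_Obj: "f \<in> Arr C \<Longrightarrow> Dom C f \<in> Obj C"
    and Cod_Obj: "f \<in> Arr C \<Longrightarrow> Cod C f \<in> Obj C"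
    and Id_Hom: "a \<in> Obj C \<Longrightarrow> Id C a \<in> Hom C a a"
    and Comp_Hom: "\<lbrakk>f \<in> Hom C a b; g \<in> Hom C b c\<rbrakk> \<Longrightarrow> g \<cdot> f \<in> Hom C a c"
    and Comp_Id: "f \<in> Hom C a b \<Longrightarrow> f \<cdot> Id C a = f"
    and Id_Comp: "f \<in> Hom C a b \<Longrightarrow> Id C b \<cdot> f = f"
    and Comp_assoc:
      "\<lbrakk>f \<in> Hom C a b; g \<in> Hom C b c; h \<in> Hom C c d\<rbrakk> \<Longrightarrow> (h \<cdot> g) \<cdot> f = h \<cdot> (g \<cdot> f)"

definition is_iso :: "('o, 'm, 'x) cat_scheme \<Rightarrow> 'm \<Rightarrow> bool"
  where "is_iso C f \<longleftrightarrow> f \<in> Arr C \<and>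
    (\<exists>g \<in> Hom C (Cod C f) (Dom C f).
      g \<cdot>\<^bsub>C\<^esub> f = Id C (Dom C f) \<and> f \<cdot>\<^bsub>C\<^esub> g = Id C (Cod C f))"

definition isomorphic :: "('o, 'm, 'x) cat_scheme \<Rightarrow> 'o \<Rightarrow> 'o \<Rightarrow> bool"
  where "isomorphic C a b \<longleftrightarrow> (\<exists>f \<in> Hom C a b. is_iso C f)"

definition is_mono :: "('o, 'm, 'x) cat_scheme \<Rightarrow> 'm \<Rightarrow> bool"
  where "is_mono C f \<longleftrightarrow> f \<in> Arr C \<and>
    (\<forall>a \<in> Obj C. \<forall>g \<in> Hom C a (Dom C f). \<forall>h \<in> Hom C a (Dom C f).
      f \<cdot>\<^bsub>C\<^esub> g = f \<cdot>\<^bsub>C\<^esub> h \<longrightarrow> g = h)"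

definition is_epi :: "('o, 'm, 'x) cat_scheme \<Rightarrow> 'm \<Rightarrow> bool"
  where "is_epi C f \<longleftrightarrow> f \<in> Arr C \<and>
    (\<forall>a \<in> Obj C. \<forall>g \<in> Hom C (Cod C f) a. \<forall>h \<in> Hom C (Cod C f) a.
      g \<cdot>\<^bsub>C\<^esub> f = h \<cdot>\<^bsub>C\<^esub> f \<longrightarrow> g = h)"

record ('o, 'm, 'p, 'n) functor_data =
  on_obj :: "'o \<Rightarrow> 'p"
  on_arr :: "'m \<Rightarrow> 'n"

definition is_functor ::
  "('o, 'm, 'x) cat_scheme \<Rightarrow> ('p, 'n, 'y) cat_scheme \<Rightarrow> ('o, 'm, 'p, 'n) functor_data \<Rightarrow> bool"
  where "is_functor C D F \<longleftrightarrow> category C \<and> category D \<and>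
    (\<forall>a \<in> Obj C. on_obj F a \<in> Obj D) \<and>
    (\<forall>a \<in> Obj C. \<forall>b \<in> Obj C. \<forall>f \<in> Hom C a b. on_arr F f \<in> Hom D (on_obj F a) (on_obj F b)) \<and>
    (\<forall>a \<in> Obj C. on_arr F (Id C a) = Id D (on_obj F a)) \<and>
    (\<forall>a \<in> Obj C. \<forall>b \<in> Obj C. \<forall>c \<in> Obj C. \<forall>f \<in> Hom C a b. \<forall>g \<in> Hom C b c.
      on_arr F (g \<cdot>\<^bsub>C\<^esub> f) = on_arr F g \<cdot>\<^bsub>D\<^esub> on_arr F f)"

text \<open>The data of the identity functor; also the data of the inclusion of a subcategory.\<close>

definition incl :: "('o, 'm, 'o, 'm) functor_data"
  where "incl = \<lparr>on_obj = (\<lambda>a. a), on_arr = (\<lambda>f. f)\<rparr>"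

definition functor_comp ::
  "('p, 'n, 'q, 'r) functor_data \<Rightarrow> ('o, 'm, 'p, 'n) functor_data \<Rightarrow> ('o, 'm, 'q, 'r) functor_data"
  where "functor_comp G F = \<lparr>on_obj = on_obj G \<circ> on_obj F, on_arr = on_arr G \<circ> on_arr F\<rparr>"

definition natural_iso ::
  "('o, 'm, 'x) cat_scheme \<Rightarrow> ('p, 'n, 'y) cat_scheme \<Rightarrow>
    ('o, 'm, 'p, 'n) functor_data \<Rightarrow> ('o, 'm, 'p, 'n) functor_data \<Rightarrow> ('o \<Rightarrow> 'n) \<Rightarrow> bool"
  where "natural_iso C D F G \<tau> \<longleftrightarrow> is_functor C D F \<and> is_functor C D G \<and>
    (\<forall>a \<in> Obj C. \<tau> a \<in> Hom D (on_obj F a) (on_obj G a) \<and> is_iso D (\<tau> a)) \<and>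
    (\<forall>a \<in> Obj C. \<forall>b \<in> Obj C. \<forall>f \<in> Hom C a b.
      on_arr G f \<cdot>\<^bsub>D\<^esub> \<tau> a = \<tau> b \<cdot>\<^bsub>D\<^esub> on_arr F f)"

definition quasi_inverse ::
  "('o, 'm, 'x) cat_scheme \<Rightarrow> ('o, 'm, 'o, 'm) functor_data \<Rightarrow> ('o, 'm, 'o, 'm) functor_data \<Rightarrow>
    ('o \<Rightarrow> 'm) \<Rightarrow> ('o \<Rightarrow> 'm) \<Rightarrow> bool"
  where "quasi_inverse C S S' \<zeta> \<theta> \<longleftrightarrow>
    natural_iso C C (functor_comp S S') incl \<zeta> \<and>
    natural_iso C C incl (functor_comp S' S) \<theta> \<and>
    is_functor C C S \<and> is_functor C C S'"

section \<open>Adjunctions\<close>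

text \<open>\<open>F\<close> from \<open>C\<close> to \<open>D\<close> is left adjoint to \<open>G\<close> by way of the natural bijections
  \<open>\<Phi> a b\<close> from \<open>Hom D (F a) b\<close> to \<open>Hom C a (G b)\<close>.\<close>

definition adjunction ::
  "('o, 'm, 'x) cat_scheme \<Rightarrow> ('p, 'n, 'y) cat_scheme \<Rightarrow>
    ('o, 'm, 'p, 'n) functor_data \<Rightarrow> ('p, 'n, 'o, 'm) functor_data \<Rightarrow>
    ('o \<Rightarrow> 'p \<Rightarrow> 'n \<Rightarrow> 'm) \<Rightarrow> bool"
  where "adjunction C D F G \<Phi> \<longleftrightarrow> is_functor C D F \<and> is_functor D C G \<and>
    (\<forall>a \<in> Obj C. \<forall>b \<in> Obj D. bij_betw (\<Phi> a b) (Hom D (on_obj F a) b) (Hom C a (on_obj G b))) \<and>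
    (\<forall>a \<in> Obj C. \<forall>a' \<in> Obj C. \<forall>b \<in> Obj D. \<forall>b' \<in> Obj D.
      \<forall>u \<in> Hom C a' a. \<forall>v \<in> Hom D b b'. \<forall>h \<in> Hom D (on_obj F a) b.
      \<Phi> a' b' (v \<cdot>\<^bsub>D\<^esub> h \<cdot>\<^bsub>D\<^esub> on_arr F u) = on_arr G v \<cdot>\<^bsub>C\<^esub> \<Phi> a b h \<cdot>\<^bsub>C\<^esub> u)"

definition left_adjoint_with_unit ::
  "('o, 'm, 'x) cat_scheme \<Rightarrow> ('p, 'n, 'y) cat_scheme \<Rightarrow>
    ('o, 'm, 'p, 'n) functor_data \<Rightarrow> ('p, 'n, 'o, 'm) functor_data \<Rightarrow> ('o \<Rightarrow> 'm) \<Rightarrow> bool"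
  where "left_adjoint_with_unit C D F G \<eta> \<longleftrightarrow>
    (\<exists>\<Phi>. adjunction C D F G \<Phi> \<and>
      (\<forall>a \<in> Obj C. \<eta> a = \<Phi> a (on_obj F a) (Id D (on_obj F a))))"

definition right_adjoint_with_counit ::
  "('o, 'm, 'x) cat_scheme \<Rightarrow> ('p, 'n, 'y) cat_scheme \<Rightarrow>
    ('o, 'm, 'p, 'n) functor_data \<Rightarrow> ('p, 'n, 'o, 'm) functor_data \<Rightarrow> ('p \<Rightarrow> 'n) \<Rightarrow> bool"
  where "right_adjoint_with_counit C D F G \<epsilon> \<longleftrightarrow>
    (\<exists>\<Phi>. adjunction C D F G \<Phi> \<and>
      (\<forall>b \<in> Obj D. \<epsilon> b \<in> Hom D (on_obj F (on_obj G b)) b \<and>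
        \<Phi> (on_obj G b) b (\<epsilon> b) = Id C (on_obj G b)))"

section \<open>Additive and abelian categories\<close>

record ('o, 'm) addcat = "('o, 'm) cat" +
  Add :: "'m \<Rightarrow> 'm \<Rightarrow> 'm"  (infixl "\<oplus>\<index>" 65)
  Zero :: "'o \<Rightarrow> 'o \<Rightarrow> 'm"

definition Hom_group :: "('o, 'm, 'x) addcat_scheme \<Rightarrow> 'o \<Rightarrow> 'o \<Rightarrow> 'm monoid"
  where "Hom_group C a b = \<lparr>carrier = Hom C a b, mult = Add C, one = Zero C a b\<rparr>"

definition Neg :: "('o, 'm, 'x) addcat_scheme \<Rightarrow> 'm \<Rightarrow> 'm"
  where "Neg C f = inv\<^bsub>Hom_group C (Dom C f) (Cod C f)\<^esub> f"

locale preadditive_category = category C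
  for C :: "('o, 'm, 'x) addcat_scheme" (structure) +
  assumes Hom_comm_group: "\<lbrakk>a \<in> Obj C; b \<in> Obj C\<rbrakk> \<Longrightarrow> comm_group (Hom_group C a b)"
    and Comp_Add_left:
      "\<lbrakk>f \<in> Hom C a b; g \<in> Hom C b c; h \<in> Hom C b c\<rbrakk> \<Longrightarrow> (g \<oplus> h) \<cdot> f = g \<cdot> f \<oplus> h \<cdot> f"
    and Comp_Add_right:
      "\<lbrakk>f \<in> Hom C a b; g \<in> Hom C a b; h \<in> Hom C b c\<rbrakk> \<Longrightarrow> h \<cdot> (f \<oplus> g) = h \<cdot> f \<oplus> h \<cdot> g"

definition is_zero_obj :: "('o, 'm, 'x) cat_scheme \<Rightarrow> 'o \<Rightarrow> bool"
  where "is_zero_obj C z \<longleftrightarrow> z \<in> Obj C \<and>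
    (\<forall>a \<in> Obj C. (\<exists>!f. f \<in> Hom C z a) \<and> (\<exists>!f. f \<in> Hom C a z))"

definition is_biproduct ::
  "('o, 'm, 'x) addcat_scheme \<Rightarrow> 'o \<Rightarrow> 'o \<Rightarrow> 'o \<Rightarrow> 'm \<Rightarrow> 'm \<Rightarrow> 'm \<Rightarrow> 'm \<Rightarrow> bool"
  where "is_biproduct C a b s i j p q \<longleftrightarrow> s \<in> Obj C \<and>
    i \<in> Hom C a s \<and> j \<in> Hom C b s \<and> p \<in> Hom C s a \<and> q \<in> Hom C s b \<and>
    p \<cdot>\<^bsub>C\<^esub> i = Id C a \<and> q \<cdot>\<^bsub>C\<^esub> j = Id C b \<and>
    p \<cdot>\<^bsub>C\<^esub> j = Zero C b a \<and> q \<cdot>\<^bsub>C\<^esub> i = Zero C a b \<and>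
    i \<cdot>\<^bsub>C\<^esub> p \<oplus>\<^bsub>C\<^esub> j \<cdot>\<^bsub>C\<^esub> q = Id C s"

locale additive_category = preadditive_category C
  for C :: "('o, 'm, 'x) addcat_scheme" (structure) +
  assumes ex_zero_obj: "\<exists>z. is_zero_obj C z"
    and ex_biproduct: "\<lbrakk>a \<in> Obj C; b \<in> Obj C\<rbrakk> \<Longrightarrow> \<exists>s i j p q. is_biproduct C a b s i j p q"

text \<open>A kernel is encoded by its canonical morphism \<open>k\<close>, the kernel object being \<open>Dom C k\<close>;
  dually for cokernels, with cokernel object \<open>Cod C k\<close>.\<close>

definition is_kernel :: "('o, 'm, 'x) addcat_scheme \<Rightarrow> 'm \<Rightarrow> 'm \<Rightarrow> bool"
  where "is_kernel C f k \<longleftrightarrow> f \<in> Arr C \<and> k \<in> Arr C \<and> Cod C k = Dom C f \<and>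
    f \<cdot>\<^bsub>C\<^esub> k = Zero C (Dom C k) (Cod C f) \<and>
    (\<forall>a \<in> Obj C. \<forall>h \<in> Hom C a (Dom C f). f \<cdot>\<^bsub>C\<^esub> h = Zero C a (Cod C f) \<longrightarrow>
      (\<exists>!u. u \<in> Hom C a (Dom C k) \<and> k \<cdot>\<^bsub>C\<^esub> u = h))"

definition is_cokernel :: "('o, 'm, 'x) addcat_scheme \<Rightarrow> 'm \<Rightarrow> 'm \<Rightarrow> bool"
  where "is_cokernel C f k \<longleftrightarrow> f \<in> Arr C \<and> k \<in> Arr C \<and> Dom C k = Cod C f \<and>
    k \<cdot>\<^bsub>C\<^esub> f = Zero C (Dom C f) (Cod C k) \<and>
    (\<forall>a \<in> Obj C. \<forall>h \<in> Hom C (Cod C f) a. h \<cdot>\<^bsub>C\<^esub> f = Zero C (Dom C f) a \<longrightarrow>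
      (\<exists>!u. u \<in> Hom C (Cod C k) a \<and> u \<cdot>\<^bsub>C\<^esub> k = h))"

locale abelian_category = additive_category C
  for C :: "('o, 'm, 'x) addcat_scheme" (structure) +
  assumes ex_kernel: "f \<in> Arr C \<Longrightarrow> \<exists>k. is_kernel C f k"
    and ex_cokernel: "f \<in> Arr C \<Longrightarrow> \<exists>k. is_cokernel C f k"
    and mono_is_kernel: "is_mono C k \<Longrightarrow> \<exists>f. is_kernel C f k"
    and epi_is_cokernel: "is_epi C k \<Longrightarrow> \<exists>f. is_cokernel C f k"

definition additive_functor ::
  "('o, 'm, 'x) addcat_scheme \<Rightarrow> ('p, 'n, 'y) addcat_scheme \<Rightarrow>
    ('o, 'm, 'p, 'n) functor_data \<Rightarrow> bool"
  where "additive_functor C D F \<longleftrightarrow> is_functor C D F \<and>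
    (\<forall>a \<in> Obj C. \<forall>b \<in> Obj C. \<forall>f \<in> Hom C a b. \<forall>g \<in> Hom C a b.
      on_arr F (f \<oplus>\<^bsub>C\<^esub> g) = on_arr F f \<oplus>\<^bsub>D\<^esub> on_arr F g)"

section \<open>Full subcategories\<close>

text \<open>Full subcategories are given by their sets of objects. Composition and addition are
  inherited, so the inclusion of an additive subcategory is an additive functor.\<close>

definition full_sub :: "('o, 'm, 'x) cat_scheme \<Rightarrow> 'o set \<Rightarrow> ('o, 'm, 'x) cat_scheme"
  where "full_sub C A = C\<lparr>Obj := A, Arr := {f \<in> Arr C. Dom C f \<in> A \<and> Cod C f \<in> A}\<rparr>"

definition iso_closed :: "('o, 'm, 'x) cat_scheme \<Rightarrow> 'o set \<Rightarrow> bool"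
  where "iso_closed C A \<longleftrightarrow> A \<subseteq> Obj C \<and> (\<forall>a \<in> A. \<forall>b \<in> Obj C. isomorphic C a b \<longrightarrow> b \<in> A)"

definition iso_closure :: "('o, 'm, 'x) cat_scheme \<Rightarrow> 'o set \<Rightarrow> 'o set"
  where "iso_closure C X = {b \<in> Obj C. \<exists>a \<in> X. isomorphic C a b}"

definition additive_subcategory :: "('o, 'm, 'x) addcat_scheme \<Rightarrow> 'o set \<Rightarrow> bool"
  where "additive_subcategory C A \<longleftrightarrow> iso_closed C A \<and> additive_category (full_sub C A) \<and>
    additive_functor (full_sub C A) C incl"

definition abelian_subcategory :: "('o, 'm, 'x) addcat_scheme \<Rightarrow> 'o set \<Rightarrow> bool"
  where "abelian_subcategory C A \<longleftrightarrow>
    additive_subcategory C A \<and> abelian_category (full_sub C A)"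

section \<open>Triangulated categories\<close>

text \<open>A triangle \<open>x \<rightarrow> y \<rightarrow> z \<rightarrow> S x\<close> is encoded by its three morphisms.\<close>

definition is_triangle ::
  "('o, 'm, 'x) cat_scheme \<Rightarrow> ('o, 'm, 'o, 'm) functor_data \<Rightarrow> 'm \<Rightarrow> 'm \<Rightarrow> 'm \<Rightarrow> bool"
  where "is_triangle T S f g h \<longleftrightarrow> f \<in> Arr T \<and> g \<in> Arr T \<and> h \<in> Arr T \<and>
    Dom T g = Cod T f \<and> Dom T h = Cod T g \<and> Cod T h = on_obj S (Dom T f)"

text \<open>The suspension is only required to be a self-equivalence, not an automorphism.\<close>

locale triangulated_category = additive_category T
  for T :: "('o, 'm, 'x) addcat_scheme" (structure) +
  fixes S :: "('o, 'm, 'o, 'm) functor_data"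
    and \<Delta> :: "('m \<times> 'm \<times> 'm) set"
  assumes suspension_additive: "additive_functor T T S"
    and suspension_equivalence: "\<exists>S' \<zeta> \<theta>. quasi_inverse T S S' \<zeta> \<theta>"
    and distinguished_triangle: "(f, g, h) \<in> \<Delta> \<Longrightarrow> is_triangle T S f g h"
    and distinguished_iso:
      "\<lbrakk>(f, g, h) \<in> \<Delta>; is_triangle T S f' g' h'; is_iso T u; is_iso T v; is_iso T w;
        u \<in> Hom T (Dom T f) (Dom T f'); v \<in> Hom T (Cod T f) (Cod T f');
        w \<in> Hom T (Cod T g) (Cod T g');
        v \<cdot> f = f' \<cdot> u; w \<cdot> g = g' \<cdot> v; on_arr S u \<cdot> h = h' \<cdot> w\<rbrakk> \<Longrightarrow> (f', g', h') \<in> \<Delta>"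
    and TR1_identity:
      "\<lbrakk>x \<in> Obj T; is_zero_obj T z\<rbrakk> \<Longrightarrow> (Id T x, Zero T x z, Zero T z (on_obj S x)) \<in> \<Delta>"
    and TR1_completion: "f \<in> Arr T \<Longrightarrow> \<exists>g h. (f, g, h) \<in> \<Delta>"
    and TR2_rotation:
      "is_triangle T S f g h \<Longrightarrow> (f, g, h) \<in> \<Delta> \<longleftrightarrow> (g, h, Neg T (on_arr S f)) \<in> \<Delta>"
    and TR3_morphism:
      "\<lbrakk>(f, g, h) \<in> \<Delta>; (f', g', h') \<in> \<Delta>;
        u \<in> Hom T (Dom T f) (Dom T f'); v \<in> Hom T (Cod T f) (Cod T f'); v \<cdot> f = f' \<cdot> u\<rbrakk>
        \<Longrightarrow> \<exists>w \<in> Hom T (Cod T g) (Cod T g'). w \<cdot> g = g' \<cdot> v \<and> on_arr S u \<cdot> h = h' \<cdot> w"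
    and TR4_octahedral:
      "\<lbrakk>Cod T f = Dom T g; (f, f1, f2) \<in> \<Delta>; (g, g1, g2) \<in> \<Delta>; (g \<cdot> f, h1, h2) \<in> \<Delta>\<rbrakk>
        \<Longrightarrow> \<exists>u v. (u, v, on_arr S f1 \<cdot> g2) \<in> \<Delta> \<and>
          u \<in> Hom T (Cod T f1) (Cod T h1) \<and> v \<in> Hom T (Cod T h1) (Cod T g1) \<and>
          u \<cdot> f1 = h1 \<cdot> g \<and> h2 \<cdot> u = f2 \<and> v \<cdot> h1 = g1 \<and> g2 \<cdot> v = on_arr S f \<cdot> h2"

definition shift_subcat ::
  "('o, 'm, 'x) cat_scheme \<Rightarrow> ('o, 'm, 'o, 'm) functor_data \<Rightarrow> 'o set \<Rightarrow> 'o set"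
  where "shift_subcat T S A = iso_closure T (on_obj S ` A)"

definition star ::
  "('o, 'm, 'x) cat_scheme \<Rightarrow> ('m \<times> 'm \<times> 'm) set \<Rightarrow> 'o set \<Rightarrow> 'o set \<Rightarrow> 'o set"
  where "star T \<Delta> X Z = {t \<in> Obj T. \<exists>f g h. (f, g, h) \<in> \<Delta> \<and>
    Dom T f \<in> X \<and> Cod T f = t \<and> Cod T g \<in> Z}"

text \<open>\<open>\<Sigma>\<^sup>-\<^sup>1 d \<rightarrow> x \<rightarrow> c \<rightarrow> d\<close> with last morphism \<open>g\<close> is distinguished if it is so after
  identifying \<open>d\<close> with \<open>\<Sigma> (\<Sigma>\<^sup>-\<^sup>1 d)\<close> along \<open>\<zeta>\<^sub>d\<close>.\<close>

definition desuspended_distinguished ::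
  "('o, 'm, 'x) cat_scheme \<Rightarrow> ('o, 'm, 'o, 'm) functor_data \<Rightarrow> ('o, 'm, 'o, 'm) functor_data \<Rightarrow>
    ('o \<Rightarrow> 'm) \<Rightarrow> ('m \<times> 'm \<times> 'm) set \<Rightarrow> 'o \<Rightarrow> 'm \<Rightarrow> 'm \<Rightarrow> 'm \<Rightarrow> bool"
  where "desuspended_distinguished T S S' \<zeta> \<Delta> d i p g \<longleftrightarrow>
    (\<exists>h \<in> Hom T (Dom T g) (on_obj S (on_obj S' d)). (i, p, h) \<in> \<Delta> \<and> g = \<zeta> d \<cdot>\<^bsub>T\<^esub> h)"

section \<open>The functors \<open>C\<^sub>T\<close> and \<open>K\<^sub>T\<close>\<close>

text \<open>Here \<open>coker\<close> and \<open>ker\<close> choose canonical morphisms, \<open>f z\<close> is the chosen morphism from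
  \<open>a\<^sub>z\<close> to \<open>b\<^sub>z\<close>, and \<open>g x\<close> the chosen morphism from \<open>c\<^sub>x\<close> to \<open>d\<^sub>x\<close>.\<close>

definition C_functor ::
  "('o, 'm, 'x) cat_scheme \<Rightarrow> ('m \<Rightarrow> 'm) \<Rightarrow> ('o \<Rightarrow> 'm) \<Rightarrow> ('o \<Rightarrow> 'm) \<Rightarrow> ('o, 'm, 'o, 'm) functor_data"
  where "C_functor T coker f \<eta> =
    \<lparr>on_obj = (\<lambda>z. Cod T (coker (f z))),
     on_arr = (\<lambda>w. THE u. u \<in> Hom T (Cod T (coker (f (Dom T w)))) (Cod T (coker (f (Cod T w)))) \<and>
       u \<cdot>\<^bsub>T\<^esub> \<eta> (Dom T w) = \<eta> (Cod T w) \<cdot>\<^bsub>T\<^esub> w)\<rparr>"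

definition K_functor ::
  "('o, 'm, 'x) cat_scheme \<Rightarrow> ('m \<Rightarrow> 'm) \<Rightarrow> ('o \<Rightarrow> 'm) \<Rightarrow> ('o \<Rightarrow> 'm) \<Rightarrow> ('o, 'm, 'o, 'm) functor_data"
  where "K_functor T ker g \<epsilon> =
    \<lparr>on_obj = (\<lambda>x. Dom T (ker (g x))),
     on_arr = (\<lambda>w. THE u. u \<in> Hom T (Dom T (ker (g (Dom T w)))) (Dom T (ker (g (Cod T w)))) \<and>
       \<epsilon> (Cod T w) \<cdot>\<^bsub>T\<^esub> u = w \<cdot>\<^bsub>T\<^esub> \<epsilon> (Dom T w))\<rparr>"

end

theory Submission
  imports Defs
begin

text \<open>A morphism \<open>h\<close> from \<open>z\<close> to an object \<open>x\<close> of \<open>A\<close> restricts along \<open>p\<^sub>z\<close> to a morphism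
  killing \<open>f\<^sub>z\<close>, which factors uniquely as \<open>u\<close> through the cokernel of \<open>f\<^sub>z\<close>. Then \<open>u \<eta>\<^sub>z\<close> and \<open>h\<close>
  agree after composition with \<open>p\<^sub>z\<close>, so their difference factors through \<open>\<Sigma> a\<^sub>z\<close>. It vanishes,
  because \<open>Hom (\<Sigma> a) x\<close> is in bijection with \<open>Hom a (\<Sigma>\<^sup>-\<^sup>1 x)\<close>, which is zero. Thus \<open>\<eta>\<^sub>z\<close> is a
  universal morphism to \<open>A\<close>. The argument for \<open>\<epsilon>\<close> is dual.\<close>

section \<open>Reflective and coreflective full subcategories\<close>

lemma full_sub_simps [simp]:
  "Obj (full_sub C A) = A" "Dom (full_sub C A) = Dom C" "Cod (full_sub C A) = Cod C"
  "Id (full_sub C A) = Id C" "Comp (full_sub C A) = Comp C"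
  by (simp_all add: full_sub_def)

lemma Zero_full_sub [simp]: "Zero (full_sub C A) = Zero C"
  by (simp add: full_sub_def)

lemma Hom_full_sub [simp]: "x \<in> A \<Longrightarrow> y \<in> A \<Longrightarrow> Hom (full_sub C A) x y = Hom C x y"
  by (auto simp: Hom_def full_sub_def)

lemma Hom_full_subD: "u \<in> Hom (full_sub C A) x y \<Longrightarrow> u \<in> Hom C x y \<and> x \<in> A \<and> y \<in> A"
  by (auto simp: Hom_def full_sub_def)

lemma Arr_full_sub: "u \<in> Hom C x y \<Longrightarrow> x \<in> A \<Longrightarrow> y \<in> A \<Longrightarrow> u \<in> Arr (full_sub C A)"
  by (auto simp: Hom_def full_sub_def)

lemma HomD: "u \<in> Hom C x y \<Longrightarrow> u \<in> Arr C \<and> Dom C u = x \<and> Cod C u = y"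
  by (simp add: Hom_def)

context category
begin

lemma Hom_Obj: "u \<in> Hom C x y \<Longrightarrow> x \<in> Obj C \<and> y \<in> Obj C"
  using Dom_Obj Cod_Obj by (auto simp: Hom_def)

lemma is_iso_inverse:
  assumes "u \<in> Hom C x y \<and> is_iso C u"
  shows "\<exists>v \<in> Hom C y x. v \<cdot> u = Id C x \<and> u \<cdot> v = Id C y"
  using assms by (auto simp: is_iso_def Hom_def)

lemma category_full_sub:
  assumes "B \<subseteq> Obj C"
  shows "category (full_sub C B)"
proof
  fix u assume "u \<in> Arr (full_sub C B)"
  then show "Dom (full_sub C B) u \<in> Obj (full_sub C B)" "Cod (full_sub C B) u \<in> Obj (full_sub C B)"
    by (auto simp: full_sub_def)
next
  fix x assume "x \<in> Obj (full_sub C B)"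
  then show "Id (full_sub C B) x \<in> Hom (full_sub C B) x x"
    using assms Id_Hom by auto
qed (auto dest!: Hom_full_subD intro: Comp_Hom Comp_Id Id_Comp Comp_assoc)

lemma is_functor_incl:
  assumes "B \<subseteq> B'" "B' \<subseteq> Obj C"
  shows "is_functor (full_sub C B) (full_sub C B') incl"
proof -
  have "B \<subseteq> Obj C" using assms by auto
  then show ?thesis
    unfolding is_functor_def incl_def
    using assms category_full_sub by (auto simp: subset_iff)
qed

text \<open>Universal morphisms, one for each object, suffice: uniqueness of factorisations gives
  functoriality, and composition with \<open>\<eta> z\<close> is the hom bijection. The functor is
  written with \<open>THE\<close> so that it matches the unfolded \<open>C_functor\<close>.\<close>

lemma reflection_left_adjoint:
  assumes DB: "D \<subseteq> B" and B: "B \<subseteq> Obj C"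
    and R: "\<And>z. z \<in> B \<Longrightarrow> R z \<in> D"
    and \<eta>: "\<And>z. z \<in> B \<Longrightarrow> \<eta> z \<in> Hom C z (R z)"
    and universal: "\<And>z x h. z \<in> B \<Longrightarrow> x \<in> D \<Longrightarrow> h \<in> Hom C z x \<Longrightarrow>
      \<exists>!u. u \<in> Hom C (R z) x \<and> u \<cdot> \<eta> z = h"
  shows "left_adjoint_with_unit (full_sub C B) (full_sub C D)
    \<lparr>on_obj = R, on_arr = (\<lambda>w. THE u. u \<in> Hom C (R (Dom C w)) (R (Cod C w)) \<and>
       u \<cdot> \<eta> (Dom C w) = \<eta> (Cod C w) \<cdot> w)\<rparr> incl \<eta>"
    (is "left_adjoint_with_unit ?B ?D \<lparr>on_obj = R, on_arr = ?L\<rparr> incl \<eta>")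
proof -
  define L where "L = ?L"
  let ?F = "\<lparr>on_obj = R, on_arr = L\<rparr>"
  let ?\<Phi> = "\<lambda>z x u. u \<cdot> \<eta> z"
  \<comment> \<open>The description is well defined: \<open>R y\<close> lies in \<open>D\<close>, so
    the universal property of \<open>\<eta> x\<close> applies to
    \<open>\<eta> y \<cdot> w\<close>.\<close>
  have F: "L w \<in> Hom C (R x) (R y) \<and> L w \<cdot> \<eta> x = \<eta> y \<cdot> w"
    if "w \<in> Hom C x y" "x \<in> B" "y \<in> B" for w x y
  proof -
    have "\<eta> y \<cdot> w \<in> Hom C x (R y)" using that \<eta> Comp_Hom by blast
    from theI'[OF universal[OF that(2) R[OF that(3)] this]] that(1)
    show ?thesis by (simp add: L_def HomD)
  qed
  have unique: "u = v" if "u \<in> Hom C (R z) x" "v \<in> Hom C (R z) x" "u \<cdot> \<eta> z = v \<cdot> \<eta> z"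
    "z \<in> B" "x \<in> D" for u v z x
  proof -
    have "u \<cdot> \<eta> z \<in> Hom C z x" using that(1,4) \<eta> Comp_Hom by blast
    from universal[OF that(4,5) this] that(1-3) show ?thesis by metis
  qed
  have "is_functor ?B ?D ?F"
    unfolding is_functor_def
  proof (intro conjI ballI)
    show "category ?B" "category ?D" using B DB category_full_sub by auto
  next
    fix x assume "x \<in> Obj ?B" then show "on_obj ?F x \<in> Obj ?D" using R by simp
  next
    fix x y w assume "x \<in> Obj ?B" "y \<in> Obj ?B" "w \<in> Hom ?B x y"
    then show "on_arr ?F w \<in> Hom ?D (on_obj ?F x) (on_obj ?F y)" using F R by simp
  next
    fix x assume "x \<in> Obj ?B"
    then have x: "x \<in> B" "R x \<in> D" "Id C x \<in> Hom C x x" "Id C (R x) \<in> Hom C (R x) (R x)"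
      using B DB R Id_Hom by auto
    note Fid = F[OF x(3,1,1)]
    have "L (Id C x) \<cdot> \<eta> x = Id C (R x) \<cdot> \<eta> x"
      using conjunct2[OF Fid] Comp_Id[OF \<eta>[OF x(1)]] Id_Comp[OF \<eta>[OF x(1)]] by metis
    then have "L (Id C x) = Id C (R x)"
      by (rule unique[OF conjunct1[OF Fid] x(4) _ x(1,2)])
    then show "on_arr ?F (Id ?B x) = Id ?D (on_obj ?F x)" by simp
  next
    fix x y z v w assume "x \<in> Obj ?B" "y \<in> Obj ?B" "z \<in> Obj ?B" "v \<in> Hom ?B x y" "w \<in> Hom ?B y z"
    then have *: "x \<in> B" "y \<in> B" "z \<in> B" "v \<in> Hom C x y" "w \<in> Hom C y z" by auto
    note Fv = F[OF *(4,1,2)] and Fw = F[OF *(5,2,3)]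
      and Fwv = F[OF Comp_Hom[OF *(4,5)] *(1,3)]
    \<comment> \<open>Two morphisms out of \<open>R x\<close> into \<open>D\<close> are compared
      after composition with \<open>\<eta> x\<close>; naturality of \<open>\<eta>\<close> is used
      for \<open>v\<close> and then for \<open>w\<close>.\<close>
    have "(L w \<cdot> L v) \<cdot> \<eta> x = L w \<cdot> (\<eta> y \<cdot> v)"
      using Fv Fw \<eta>[OF *(1)] Comp_assoc by metis
    also have "\<dots> = (\<eta> z \<cdot> w) \<cdot> v"
      using Fw *(4) \<eta>[OF *(2)] Comp_assoc by metis
    also have "\<dots> = \<eta> z \<cdot> (w \<cdot> v)"
      using * \<eta> Comp_assoc by metis
    finally have "L (w \<cdot> v) \<cdot> \<eta> x = (L w \<cdot> L v) \<cdot> \<eta> x"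
      using conjunct2[OF Fwv] by (simp only:)
    then have "L (w \<cdot> v) = L w \<cdot> L v"
      by (rule unique[OF conjunct1[OF Fwv] Comp_Hom[OF conjunct1[OF Fv] conjunct1[OF Fw]] _ *(1) R[OF *(3)]])
    then show "on_arr ?F (w \<cdot>\<^bsub>?B\<^esub> v) = on_arr ?F w \<cdot>\<^bsub>?D\<^esub> on_arr ?F v" by simp
  qed
  moreover have "bij_betw (?\<Phi> z x) (Hom ?D (on_obj ?F z) x) (Hom ?B z (on_obj incl x))"
    if "z \<in> Obj ?B" "x \<in> Obj ?D" for z x
  proof -
    from that DB R have z: "z \<in> B" "x \<in> D" "x \<in> B" "R z \<in> D" by auto
    \<comment> \<open>Surjectivity is the existence part of the universal property; injectivity is
      \<open>unique\<close>.\<close>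
    have "h \<in> ?\<Phi> z x ` Hom C (R z) x" if "h \<in> Hom C z x" for h
      using universal[OF z(1,2) that] by auto
    moreover have "?\<Phi> z x u \<in> Hom C z x" if "u \<in> Hom C (R z) x" for u
      using that \<eta>[OF z(1)] Comp_Hom by blast
    ultimately have "bij_betw (?\<Phi> z x) (Hom C (R z) x) (Hom C z x)"
      unfolding bij_betw_def inj_on_def using unique z by blast
    then show ?thesis using z by (simp add: incl_def)
  qed
  moreover have "?\<Phi> x' y' (v \<cdot>\<^bsub>?D\<^esub> h \<cdot>\<^bsub>?D\<^esub> on_arr ?F u) = on_arr incl v \<cdot>\<^bsub>?B\<^esub> ?\<Phi> x y h \<cdot>\<^bsub>?B\<^esub> u"
    if "x \<in> Obj ?B" "x' \<in> Obj ?B" "y \<in> Obj ?D" "y' \<in> Obj ?D" "u \<in> Hom ?B x' x" "v \<in> Hom ?D y y'"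
      "h \<in> Hom ?D (on_obj ?F x) y" for x x' y y' u v h
  proof -
    from that R have *: "x \<in> B" "x' \<in> B" "y \<in> D" "y' \<in> D" "u \<in> Hom C x' x" "v \<in> Hom C y y'"
      "h \<in> Hom C (R x) y" by auto
    note Fu = F[OF *(5,2,1)]
    have vh: "v \<cdot> h \<in> Hom C (R x) y'" using * Comp_Hom by blast
    have "(v \<cdot> h \<cdot> L u) \<cdot> \<eta> x' = (v \<cdot> h) \<cdot> (\<eta> x \<cdot> u)"
      using Fu vh \<eta>[OF *(2)] Comp_assoc by metis
    also have "\<dots> = (v \<cdot> h) \<cdot> \<eta> x \<cdot> u"
      using vh \<eta>[OF *(1)] *(5) Comp_assoc by metis
    also have "\<dots> = v \<cdot> (h \<cdot> \<eta> x) \<cdot> u"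
      using *(6,7) \<eta>[OF *(1)] Comp_assoc by metis
    finally show ?thesis by (simp add: incl_def)
  qed
  ultimately have "adjunction ?B ?D ?F incl ?\<Phi>"
    unfolding adjunction_def using is_functor_incl[OF DB B] by blast
  moreover have "\<eta> z = ?\<Phi> z (on_obj ?F z) (Id ?D (on_obj ?F z))" if "z \<in> Obj ?B" for z
    using Id_Comp \<eta> that by fastforce
  ultimately show ?thesis
    unfolding left_adjoint_with_unit_def L_def by blast
qed

text \<open>Dual to \<open>reflection_left_adjoint\<close>, carried out directly with arrows
  reversed. The direction of the bijection fixed in \<open>adjunction\<close> now runs from
  morphisms into \<open>z\<close> to their factorisations through
  \<open>\<epsilon> z\<close>.\<close>

lemma coreflection_right_adjoint:
  assumes DB: "D \<subseteq> B" and B: "B \<subseteq> Obj C"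
    and R: "\<And>z. z \<in> B \<Longrightarrow> R z \<in> D"
    and \<epsilon>: "\<And>z. z \<in> B \<Longrightarrow> \<epsilon> z \<in> Hom C (R z) z"
    and universal: "\<And>z x h. z \<in> B \<Longrightarrow> x \<in> D \<Longrightarrow> h \<in> Hom C x z \<Longrightarrow>
      \<exists>!u. u \<in> Hom C x (R z) \<and> \<epsilon> z \<cdot> u = h"
  shows "right_adjoint_with_counit (full_sub C D) (full_sub C B) incl
    \<lparr>on_obj = R, on_arr = (\<lambda>w. THE u. u \<in> Hom C (R (Dom C w)) (R (Cod C w)) \<and>
       \<epsilon> (Cod C w) \<cdot> u = w \<cdot> \<epsilon> (Dom C w))\<rparr> \<epsilon>"
    (is "right_adjoint_with_counit ?D ?B incl \<lparr>on_obj = R, on_arr = ?L\<rparr> \<epsilon>")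
proof -
  define L where "L = ?L"
  let ?G = "\<lparr>on_obj = R, on_arr = L\<rparr>"
  \<comment> \<open>The bijection is the inverse of composition with \<open>\<epsilon> z\<close>,
    hence the definite description.\<close>
  define \<Phi> where "\<Phi> x z h = (THE u. u \<in> Hom C x (R z) \<and> \<epsilon> z \<cdot> u = h)" for x z h
  have \<Phi>: "\<Phi> x z h \<in> Hom C x (R z) \<and> \<epsilon> z \<cdot> \<Phi> x z h = h"
    if "h \<in> Hom C x z" "x \<in> D" "z \<in> B" for x z h
    unfolding \<Phi>_def using theI'[OF universal[OF that(3,2,1)]] .
  have G: "L w \<in> Hom C (R x) (R y) \<and> \<epsilon> y \<cdot> L w = w \<cdot> \<epsilon> x"
    if "w \<in> Hom C x y" "x \<in> B" "y \<in> B" for w x y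
  proof -
    have "w \<cdot> \<epsilon> x \<in> Hom C (R x) y" using that \<epsilon> Comp_Hom by blast
    from theI'[OF universal[OF that(3) R[OF that(2)] this]] that(1)
    show ?thesis by (simp add: L_def HomD)
  qed
  have unique: "u = v" if "u \<in> Hom C x (R z)" "v \<in> Hom C x (R z)" "\<epsilon> z \<cdot> u = \<epsilon> z \<cdot> v"
    "z \<in> B" "x \<in> D" for u v z x
  proof -
    have "\<epsilon> z \<cdot> u \<in> Hom C x z" using that(1,4) \<epsilon> Comp_Hom by blast
    from universal[OF that(4,5) this] that(1-3) show ?thesis by metis
  qed
  have "is_functor ?B ?D ?G"
    unfolding is_functor_def
  proof (intro conjI ballI)
    show "category ?B" "category ?D" using B DB category_full_sub by auto
  next
    fix x assume "x \<in> Obj ?B" then show "on_obj ?G x \<in> Obj ?D" using R by simp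
  next
    fix x y w assume "x \<in> Obj ?B" "y \<in> Obj ?B" "w \<in> Hom ?B x y"
    then show "on_arr ?G w \<in> Hom ?D (on_obj ?G x) (on_obj ?G y)" using G R by simp
  next
    fix x assume "x \<in> Obj ?B"
    then have x: "x \<in> B" "R x \<in> D" "Id C x \<in> Hom C x x" "Id C (R x) \<in> Hom C (R x) (R x)"
      using B DB R Id_Hom by auto
    note Gid = G[OF x(3,1,1)]
    have "\<epsilon> x \<cdot> L (Id C x) = \<epsilon> x \<cdot> Id C (R x)"
      using conjunct2[OF Gid] Comp_Id[OF \<epsilon>[OF x(1)]] Id_Comp[OF \<epsilon>[OF x(1)]] by metis
    then have "L (Id C x) = Id C (R x)"
      by (rule unique[OF conjunct1[OF Gid] x(4) _ x(1,2)])
    then show "on_arr ?G (Id ?B x) = Id ?D (on_obj ?G x)" by simp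
  next
    fix x y z v w assume "x \<in> Obj ?B" "y \<in> Obj ?B" "z \<in> Obj ?B" "v \<in> Hom ?B x y" "w \<in> Hom ?B y z"
    then have *: "x \<in> B" "y \<in> B" "z \<in> B" "v \<in> Hom C x y" "w \<in> Hom C y z" by auto
    note Gv = G[OF *(4,1,2)] and Gw = G[OF *(5,2,3)]
      and Gwv = G[OF Comp_Hom[OF *(4,5)] *(1,3)]
    have "\<epsilon> z \<cdot> (L w \<cdot> L v) = (w \<cdot> \<epsilon> y) \<cdot> L v"
      using Gv Gw \<epsilon>[OF *(3)] Comp_assoc by metis
    also have "\<dots> = w \<cdot> (v \<cdot> \<epsilon> x)"
      using Gv *(5) \<epsilon>[OF *(2)] Comp_assoc by metis
    also have "\<dots> = (w \<cdot> v) \<cdot> \<epsilon> x"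
      using * \<epsilon> Comp_assoc by metis
    finally have "\<epsilon> z \<cdot> L (w \<cdot> v) = \<epsilon> z \<cdot> (L w \<cdot> L v)"
      using conjunct2[OF Gwv] by (simp only:)
    then have "L (w \<cdot> v) = L w \<cdot> L v"
      by (rule unique[OF conjunct1[OF Gwv] Comp_Hom[OF conjunct1[OF Gv] conjunct1[OF Gw]] _ *(3) R[OF *(1)]])
    then show "on_arr ?G (w \<cdot>\<^bsub>?B\<^esub> v) = on_arr ?G w \<cdot>\<^bsub>?D\<^esub> on_arr ?G v" by simp
  qed
  moreover have "bij_betw (\<Phi> x z) (Hom ?B (on_obj incl x) z) (Hom ?D x (on_obj ?G z))"
    if "x \<in> Obj ?D" "z \<in> Obj ?B" for z x
  proof -
    from that DB R have z: "z \<in> B" "x \<in> D" "x \<in> B" "R z \<in> D" by auto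
    have comp: "\<epsilon> z \<cdot> u \<in> Hom C x z" if "u \<in> Hom C x (R z)" for u
      using that \<epsilon>[OF z(1)] Comp_Hom by blast
    have "bij_betw (\<Phi> x z) (Hom C x z) (Hom C x (R z))"
    \<comment> \<open>Composition with \<open>\<epsilon> z\<close> is the inverse. That it is undone
      by \<open>\<Phi>\<close> needs uniqueness; the other identity is the defining property of
      \<open>\<Phi>\<close>.\<close>
    proof (rule bij_betw_byWitness[where f' = "\<lambda>u. \<epsilon> z \<cdot> u"])
      show "\<forall>u \<in> Hom C x (R z). \<Phi> x z (\<epsilon> z \<cdot> u) = u"
      proof
        fix u assume u: "u \<in> Hom C x (R z)"
        then show "\<Phi> x z (\<epsilon> z \<cdot> u) = u"
          using \<Phi>[OF comp[OF u] z(2,1)] unique[OF _ u _ z(1,2)] by blast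
      qed
    qed (use \<Phi> comp z in auto)
    then show ?thesis using z by (simp add: incl_def)
  qed
  moreover have "\<Phi> x' y' (v \<cdot>\<^bsub>?B\<^esub> h \<cdot>\<^bsub>?B\<^esub> on_arr incl u) = on_arr ?G v \<cdot>\<^bsub>?D\<^esub> \<Phi> x y h \<cdot>\<^bsub>?D\<^esub> u"
    if "x \<in> Obj ?D" "x' \<in> Obj ?D" "y \<in> Obj ?B" "y' \<in> Obj ?B" "u \<in> Hom ?D x' x" "v \<in> Hom ?B y y'"
      "h \<in> Hom ?B (on_obj incl x) y" for x x' y y' u v h
  proof -
    from that DB have *: "x \<in> D" "x' \<in> D" "y \<in> B" "y' \<in> B" "u \<in> Hom C x' x" "v \<in> Hom C y y'"
      "h \<in> Hom C x y" by (auto simp: incl_def subset_iff)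
    note Gv = G[OF *(6,3,4)] and \<Phi>h = \<Phi>[OF *(7,1,3)]
    have vhu: "v \<cdot> h \<cdot> u \<in> Hom C x' y'" and Lh: "L v \<cdot> \<Phi> x y h \<in> Hom C x (R y')"
      using * Gv \<Phi>h Comp_Hom by blast+
    \<comment> \<open>Both sides of the naturality equation end in \<open>R y'\<close>, so they may
      be compared after composition with \<open>\<epsilon> y'\<close>, where both become
      \<open>v \<cdot> h \<cdot> u\<close>.\<close>
    have "\<epsilon> y' \<cdot> (L v \<cdot> \<Phi> x y h \<cdot> u) = \<epsilon> y' \<cdot> (L v \<cdot> \<Phi> x y h) \<cdot> u"
      using Lh *(5) \<epsilon>[OF *(4)] Comp_assoc by metis
    also have "\<dots> = v \<cdot> \<epsilon> y \<cdot> \<Phi> x y h \<cdot> u"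
      using Gv \<Phi>h \<epsilon>[OF *(4)] Comp_assoc by metis
    also have "\<dots> = v \<cdot> h \<cdot> u"
      using *(6) \<Phi>h \<epsilon>[OF *(3)] Comp_assoc by metis
    finally have "\<Phi> x' y' (v \<cdot> h \<cdot> u) = L v \<cdot> \<Phi> x y h \<cdot> u"
      using \<Phi>[OF vhu *(2,4)] unique[OF _ Comp_Hom[OF *(5) Lh] _ *(4,2)] by simp
    then show ?thesis by (simp add: incl_def)
  qed
  ultimately have "adjunction ?D ?B incl ?G \<Phi>"
    unfolding adjunction_def using is_functor_incl[OF DB B] by blast
  moreover have "\<epsilon> z \<in> Hom ?B (on_obj incl (on_obj ?G z)) z \<and>
    \<Phi> (on_obj ?G z) z (\<epsilon> z) = Id ?D (on_obj ?G z)" if "z \<in> Obj ?B" for z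
  proof -
    from that DB R B have z: "z \<in> B" "R z \<in> D" "R z \<in> B" "R z \<in> Obj C" by auto
    have "\<Phi> (R z) z (\<epsilon> z) = Id C (R z)"
      using \<Phi>[OF \<epsilon>[OF z(1)] z(2,1)] Comp_Id[OF \<epsilon>[OF z(1)]] Id_Hom[OF z(4)] unique z(1,2) by metis
    then show ?thesis using z \<epsilon> by (simp add: incl_def)
  qed
  ultimately show ?thesis
    unfolding right_adjoint_with_counit_def L_def by blast
qed

end

section \<open>Zero morphisms\<close>

context preadditive_category
begin

lemma Zero_Hom: "x \<in> Obj C \<Longrightarrow> y \<in> Obj C \<Longrightarrow> Zero C x y \<in> Hom C x y"
proof -
  assume "x \<in> Obj C" "y \<in> Obj C"
  then interpret G: comm_group "Hom_group C x y" by (rule Hom_comm_group)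
  show ?thesis using G.one_closed by (simp add: Hom_group_def)
qed

text \<open>Cancellation in the group of morphisms. It shows that composition and the suspension
  preserve zero, since the image of zero equals its own double.\<close>

lemma Add_idem_Zero:
  assumes u: "u \<in> Hom C x y" and "u \<oplus> u = u"
  shows "u = Zero C x y"
proof -
  interpret G: comm_group "Hom_group C x y" using Hom_comm_group Hom_Obj[OF u] by blast
  show ?thesis using G.l_cancel_one[of u u] assms by (simp add: Hom_group_def)
qed

lemma Zero_Add:
  assumes u: "u \<in> Hom C x y"
  shows "Zero C x y \<oplus> u = u"
proof -
  interpret G: comm_group "Hom_group C x y" using Hom_comm_group Hom_Obj[OF u] by blast
  show ?thesis using G.l_one[of u] assms by (simp add: Hom_group_def)
qed

lemma Comp_Zero:
  assumes u: "u \<in> Hom C y z" and x: "x \<in> Obj C"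
  shows "u \<cdot> Zero C x y = Zero C x z"
proof -
  note 0 = Zero_Hom[OF x conjunct1[OF Hom_Obj[OF u]]]
  show ?thesis
    using Comp_Add_right[OF 0 0 u] Zero_Add[OF 0] by (intro Add_idem_Zero Comp_Hom[OF 0 u]) simp
qed

lemma Zero_Comp:
  assumes u: "u \<in> Hom C x y" and z: "z \<in> Obj C"
  shows "Zero C y z \<cdot> u = Zero C x z"
proof -
  note 0 = Zero_Hom[OF conjunct2[OF Hom_Obj[OF u]] z]
  show ?thesis
    using Comp_Add_left[OF u 0 0] Zero_Add[OF 0] by (intro Add_idem_Zero Comp_Hom[OF u 0]) simp
qed

lemma Neg_right:
  assumes u: "u \<in> Hom C x y"
  shows "Neg C u \<in> Hom C x y \<and> u \<oplus> Neg C u = Zero C x y"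
proof -
  interpret G: comm_group "Hom_group C x y" using Hom_comm_group Hom_Obj[OF u] by blast
  have "Neg C u = inv\<^bsub>Hom_group C x y\<^esub> u" using HomD[OF u] by (simp add: Neg_def)
  then show ?thesis using G.inv_closed[of u] G.r_inv[of u] u by (simp add: Hom_group_def)
qed

lemma Add_right_cancel:
  assumes "u \<in> Hom C x y" "v \<in> Hom C x y" "w \<in> Hom C x y" "u \<oplus> w = v \<oplus> w"
  shows "u = v"
proof -
  interpret G: comm_group "Hom_group C x y" using Hom_comm_group Hom_Obj[OF assms(1)] by blast
  show ?thesis using G.right_cancel[of w u v] assms by (simp add: Hom_group_def)
qed

lemma Add_comm:
  assumes "u \<in> Hom C x y" "v \<in> Hom C x y"
  shows "u \<oplus> v = v \<oplus> u"
proof -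
  interpret G: comm_group "Hom_group C x y" using Hom_comm_group Hom_Obj[OF assms(1)] by blast
  show ?thesis using G.m_comm[of u v] assms by (simp add: Hom_group_def)
qed

lemma Add_closed:
  assumes "u \<in> Hom C x y" "v \<in> Hom C x y"
  shows "u \<oplus> v \<in> Hom C x y"
proof -
  interpret G: comm_group "Hom_group C x y" using Hom_comm_group Hom_Obj[OF assms(1)] by blast
  show ?thesis using G.m_closed[of u v] assms by (simp add: Hom_group_def)
qed

text \<open>The difference \<open>u \<oplus> Neg C v\<close> is killed by \<open>e\<close>. The
  assumption \<open>inj\<close> concerns the single target \<open>z\<close>, which is the form in
  which cancellation arises from vanishing of morphisms.\<close>

lemma eq_if_Comp_eq_right:
  assumes e: "e \<in> Hom C x y"
    and inj: "\<And>w. w \<in> Hom C y z \<Longrightarrow> w \<cdot> e = Zero C x z \<Longrightarrow> w = Zero C y z"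
    and u: "u \<in> Hom C y z" and v: "v \<in> Hom C y z" and eq: "u \<cdot> e = v \<cdot> e"
  shows "u = v"
proof -
  note n = Neg_right[OF v]
  \<comment> \<open>Keeping \<open>v \<oplus> Neg C v\<close> in place of zero lets distributivity
    alone do the work, without a rule for composing negatives.\<close>
  have "(u \<oplus> Neg C v) \<cdot> e = (v \<oplus> Neg C v) \<cdot> e"
    using Comp_Add_left[OF e u conjunct1[OF n]] Comp_Add_left[OF e v conjunct1[OF n]] eq by simp
  also have "\<dots> = Zero C x z" using n Zero_Comp[OF e] Hom_Obj[OF u] by simp
  finally have "u \<oplus> Neg C v = v \<oplus> Neg C v" using inj Add_closed u n by simp
  then show ?thesis using Add_right_cancel u v n by blast
qed

lemma eq_if_Comp_eq_left:
  assumes e: "e \<in> Hom C y z"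
    and inj: "\<And>w. w \<in> Hom C x y \<Longrightarrow> e \<cdot> w = Zero C x z \<Longrightarrow> w = Zero C x y"
    and u: "u \<in> Hom C x y" and v: "v \<in> Hom C x y" and eq: "e \<cdot> u = e \<cdot> v"
  shows "u = v"
proof -
  note n = Neg_right[OF v]
  have "e \<cdot> (u \<oplus> Neg C v) = e \<cdot> (v \<oplus> Neg C v)"
    using Comp_Add_right[OF u conjunct1[OF n] e] Comp_Add_right[OF v conjunct1[OF n] e] eq by simp
  also have "\<dots> = Zero C x z" using n Comp_Zero[OF e] Hom_Obj[OF u] by simp
  finally have "u \<oplus> Neg C v = v \<oplus> Neg C v" using inj Add_closed u n by simp
  then show ?thesis using Add_right_cancel u v n by blast
qed

lemma zero_obj_Hom:
  assumes z: "is_zero_obj C z" and x: "x \<in> Obj C"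
  shows "u \<in> Hom C z x \<Longrightarrow> u = Zero C z x" and "u \<in> Hom C x z \<Longrightarrow> u = Zero C x z"
proof -
  have "\<exists>!f. f \<in> Hom C z x" "\<exists>!f. f \<in> Hom C x z" "z \<in> Obj C"
    using assms by (simp_all add: is_zero_obj_def)
  then show "u \<in> Hom C z x \<Longrightarrow> u = Zero C z x" "u \<in> Hom C x z \<Longrightarrow> u = Zero C x z"
    using Zero_Hom x by blast+
qed

text \<open>Every morphism into or out of \<open>z\<close> factors through the identity of
  \<open>z\<close>.\<close>

lemma is_zero_objI:
  assumes z: "z \<in> Obj C" and Id: "Id C z = Zero C z z"
  shows "is_zero_obj C z"
proof -
  have "u = Zero C z x" if "u \<in> Hom C z x" for u x
    using Comp_Zero[OF that z] Comp_Id[OF that] Id by simp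
  moreover have "u = Zero C x z" if "u \<in> Hom C x z" for u x
    using Zero_Comp[OF that z] Id_Comp[OF that] Id by simp
  ultimately show ?thesis
    unfolding is_zero_obj_def using z Zero_Hom by metis
qed

end

section \<open>Triangles and the suspension\<close>

context triangulated_category
begin

lemma functor_S: "is_functor T T S"
  using suspension_additive by (simp add: additive_functor_def)

lemma S_Obj: "x \<in> Obj T \<Longrightarrow> on_obj S x \<in> Obj T"
  using functor_S by (simp add: is_functor_def)

lemma S_Hom: "u \<in> Hom T x y \<Longrightarrow> on_arr S u \<in> Hom T (on_obj S x) (on_obj S y)"
  using functor_S Hom_Obj by (simp add: is_functor_def)

lemma S_Zero:
  assumes "x \<in> Obj T" "y \<in> Obj T"
  shows "on_arr S (Zero T x y) = Zero T (on_obj S x) (on_obj S y)"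
proof -
  note 0 = Zero_Hom[OF assms]
  have "on_arr S (Zero T x y) \<oplus> on_arr S (Zero T x y) = on_arr S (Zero T x y \<oplus> Zero T x y)"
    using suspension_additive assms 0 by (simp add: additive_functor_def)
  then show ?thesis using Add_idem_Zero[OF S_Hom[OF 0]] Zero_Add[OF 0] by simp
qed

lemma S_zero_obj:
  assumes "is_zero_obj T z"
  shows "is_zero_obj T (on_obj S z)"
proof -
  have z: "z \<in> Obj T" using assms by (simp add: is_zero_obj_def)
  have "Id T (on_obj S z) = on_arr S (Id T z)" using functor_S z by (simp add: is_functor_def)
  also have "\<dots> = Zero T (on_obj S z) (on_obj S z)"
    using zero_obj_Hom[OF assms z Id_Hom[OF z]] S_Zero[OF z z] by simp
  finally show ?thesis using is_zero_objI S_Obj z by blast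
qed

lemma distinguished_Hom:
  assumes "(f, g, h) \<in> \<Delta>"
  shows "f \<in> Hom T (Dom T f) (Cod T f)" "g \<in> Hom T (Cod T f) (Cod T g)"
    "h \<in> Hom T (Cod T g) (on_obj S (Dom T f))"
  using distinguished_triangle[OF assms] by (auto simp: is_triangle_def Hom_def)

lemma distinguished_rotate: "(f, g, h) \<in> \<Delta> \<Longrightarrow> (g, h, Neg T (on_arr S f)) \<in> \<Delta>"
  using TR2_rotation distinguished_triangle by blast

text \<open>Its rotation is the identity triangle of TR1 with zero object \<open>on_obj S z\<close>;
  the sign is harmless because the last morphism starts at a zero object. Rotation is then read
  backwards.\<close>

lemma distinguished_zero_Id:
  assumes x: "x \<in> Obj T" and z: "is_zero_obj T z"
  shows "(Zero T z x, Id T x, Zero T x (on_obj S z)) \<in> \<Delta>"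
proof -
  note Sz = S_zero_obj[OF z]
  have zO: "z \<in> Obj T" "on_obj S z \<in> Obj T" using z Sz by (simp_all add: is_zero_obj_def)
  note 0 = Zero_Hom[OF zO(1) x]
  have "Neg T (on_arr S (Zero T z x)) = Zero T (on_obj S z) (on_obj S x)"
    using zero_obj_Hom(1)[OF Sz S_Obj[OF x]] Neg_right[OF S_Hom[OF 0]] by blast
  moreover have "is_triangle T S (Zero T z x) (Id T x) (Zero T x (on_obj S z))"
    using HomD[OF 0] HomD[OF Id_Hom[OF x]] HomD[OF Zero_Hom[OF x zO(2)]]
    by (simp add: is_triangle_def)
  ultimately show ?thesis
    using TR1_identity[OF x Sz] TR2_rotation by simp
qed

text \<open>TR3 maps the identity triangle on \<open>Dom T f\<close> to the given one by the
  identity and \<open>f\<close>. Its third component starts at a zero object, and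
  \<open>g \<cdot> f\<close> factors through it.\<close>

lemma distinguished_Comp_Zero:
  assumes t: "(f, g, h) \<in> \<Delta>"
  shows "g \<cdot> f = Zero T (Dom T f) (Cod T g)"
proof -
  obtain z where z: "is_zero_obj T z" using ex_zero_obj by blast
  note H = distinguished_Hom[OF t]
  have O: "Dom T f \<in> Obj T" "Cod T g \<in> Obj T" "z \<in> Obj T"
    using Hom_Obj H z by (auto simp: is_zero_obj_def)
  note I = HomD[OF Id_Hom[OF O(1)]] and 0 = HomD[OF Zero_Hom[OF O(1,3)]]
  have "\<exists>w \<in> Hom T z (Cod T g). w \<cdot> Zero T (Dom T f) z = g \<cdot> f"
    using TR3_morphism[OF TR1_identity[OF O(1) z] t, of "Id T (Dom T f)" f] H(1) I 0 Id_Hom[OF O(1)]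
    by auto
  then show ?thesis using Comp_Zero O by metis
qed

text \<open>TR3 maps the given triangle to the one formed by a zero object and the identity of
  \<open>x\<close>, with \<open>k\<close> in the middle; the third component is the
  factorisation.\<close>

lemma distinguished_weak_cokernel:
  assumes t: "(f, g, h) \<in> \<Delta>" and k: "k \<in> Hom T (Cod T f) x"
    and kf: "k \<cdot> f = Zero T (Dom T f) x"
  shows "\<exists>l \<in> Hom T (Cod T g) x. l \<cdot> g = k"
proof -
  obtain z where z: "is_zero_obj T z" using ex_zero_obj by blast
  note H = distinguished_Hom[OF t]
  have O: "Dom T f \<in> Obj T" "x \<in> Obj T" "z \<in> Obj T"
    using Hom_Obj H k z by (auto simp: is_zero_obj_def)
  note I = HomD[OF Id_Hom[OF O(2)]] and 0 = HomD[OF Zero_Hom[OF O(3,2)]]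
  have "k \<cdot> f = Zero T z x \<cdot> Zero T (Dom T f) z"
    using kf Zero_Comp Zero_Hom O by metis
  then show ?thesis
    using TR3_morphism[OF t distinguished_zero_Id[OF O(2) z], of "Zero T (Dom T f) z" k]
      Zero_Hom[OF O(1,3)] k I 0 Id_Comp[OF k] by auto
qed

text \<open>Rotating back is only possible up to the equivalence \<open>S\<close>, so the factorisation of \<open>k\<close>
  through \<open>f\<close> is stated after suspension, with the signs that rotation produces.\<close>

lemma distinguished_weak_kernel_S:
  assumes t: "(f, g, h) \<in> \<Delta>" and k: "k \<in> Hom T x (Cod T f)"
    and gk: "g \<cdot> k = Zero T x (Cod T g)"
  shows "\<exists>w \<in> Hom T (on_obj S x) (on_obj S (Dom T f)).
    on_arr S k \<cdot> Neg T (on_arr S (Id T x)) = Neg T (on_arr S f) \<cdot> w"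
proof -
  obtain z where z: "is_zero_obj T z" using ex_zero_obj by blast
  note H = distinguished_Hom[OF t]
  have O: "Cod T g \<in> Obj T" "x \<in> Obj T" "z \<in> Obj T" "on_obj S x \<in> Obj T"
    using Hom_Obj H k z S_Obj by (auto simp: is_zero_obj_def)
  note 0 = HomD[OF Zero_Hom[OF O(2,3)]] HomD[OF Zero_Hom[OF O(3,4)]]
  \<comment> \<open>This is the square fed to TR3 for both triangles rotated once, the first being
    the identity triangle on \<open>x\<close>. The required equation is the last square of the
    resulting morphism of triangles.\<close>
  have "Zero T z (Cod T g) \<cdot> Zero T x z = g \<cdot> k"
    using gk Zero_Comp Zero_Hom O by metis
  then show ?thesis
    using TR3_morphism[OF distinguished_rotate[OF TR1_identity[OF O(2) z]] distinguished_rotate[OF t],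
        of k "Zero T z (Cod T g)"]
      Zero_Hom[OF O(3,1)] k HomD[OF H(2)] HomD[OF H(3)] 0 by auto
qed

end

section \<open>The suspension with a chosen quasi-inverse\<close>

locale desuspended_category = triangulated_category T S \<Delta>
  for T :: "('o, 'm, 'x) addcat_scheme" (structure)
    and S :: "('o, 'm, 'o, 'm) functor_data" and \<Delta> :: "('m \<times> 'm \<times> 'm) set" +
  fixes S' :: "('o, 'm, 'o, 'm) functor_data" and \<zeta> \<theta> :: "'o \<Rightarrow> 'm"
  assumes desuspension: "quasi_inverse T S S' \<zeta> \<theta>"
begin

lemma functor_S': "is_functor T T S'"
  using desuspension by (simp add: quasi_inverse_def)

lemma S'_Obj: "x \<in> Obj T \<Longrightarrow> on_obj S' x \<in> Obj T"
  using functor_S' by (simp add: is_functor_def)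

lemma S'_Hom: "u \<in> Hom T x y \<Longrightarrow> on_arr S' u \<in> Hom T (on_obj S' x) (on_obj S' y)"
  using functor_S' Hom_Obj by (simp add: is_functor_def)

lemma \<zeta>_inverse:
  assumes "x \<in> Obj T"
  shows "\<zeta> x \<in> Hom T (on_obj S (on_obj S' x)) x"
    and "\<exists>\<zeta>' \<in> Hom T x (on_obj S (on_obj S' x)).
      \<zeta>' \<cdot> \<zeta> x = Id T (on_obj S (on_obj S' x)) \<and> \<zeta> x \<cdot> \<zeta>' = Id T x"
proof -
  have *: "\<zeta> x \<in> Hom T (on_obj S (on_obj S' x)) x \<and> is_iso T (\<zeta> x)"
    using desuspension assms
    by (simp add: quasi_inverse_def natural_iso_def functor_comp_def incl_def)
  then show "\<zeta> x \<in> Hom T (on_obj S (on_obj S' x)) x" by simp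
  from * show "\<exists>\<zeta>' \<in> Hom T x (on_obj S (on_obj S' x)).
      \<zeta>' \<cdot> \<zeta> x = Id T (on_obj S (on_obj S' x)) \<and> \<zeta> x \<cdot> \<zeta>' = Id T x"
    using is_iso_inverse by blast
qed

lemma \<theta>_inverse:
  assumes "x \<in> Obj T"
  shows "\<theta> x \<in> Hom T x (on_obj S' (on_obj S x))"
    and "\<exists>\<theta>' \<in> Hom T (on_obj S' (on_obj S x)) x.
      \<theta>' \<cdot> \<theta> x = Id T x \<and> \<theta> x \<cdot> \<theta>' = Id T (on_obj S' (on_obj S x))"
proof -
  have *: "\<theta> x \<in> Hom T x (on_obj S' (on_obj S x)) \<and> is_iso T (\<theta> x)"
    using desuspension assms
    by (simp add: quasi_inverse_def natural_iso_def functor_comp_def incl_def)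
  then show "\<theta> x \<in> Hom T x (on_obj S' (on_obj S x))" by simp
  from * show "\<exists>\<theta>' \<in> Hom T (on_obj S' (on_obj S x)) x.
      \<theta>' \<cdot> \<theta> x = Id T x \<and> \<theta> x \<cdot> \<theta>' = Id T (on_obj S' (on_obj S x))"
    using is_iso_inverse by blast
qed

lemma \<zeta>_natural: "u \<in> Hom T x y \<Longrightarrow> u \<cdot> \<zeta> x = \<zeta> y \<cdot> on_arr S (on_arr S' u)"
  using desuspension Hom_Obj
  by (simp add: quasi_inverse_def natural_iso_def functor_comp_def incl_def)

lemma \<theta>_natural: "u \<in> Hom T x y \<Longrightarrow> on_arr S' (on_arr S u) \<cdot> \<theta> x = \<theta> y \<cdot> u"
  using desuspension Hom_Obj
  by (simp add: quasi_inverse_def natural_iso_def functor_comp_def incl_def)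

text \<open>By naturality of \<open>\<theta>\<close>, the morphism \<open>on_arr S u\<close>
  determines \<open>\<theta> y \<cdot> u\<close>, and \<open>\<theta> y\<close> has a left
  inverse.\<close>

lemma S_faithful:
  assumes u: "u \<in> Hom T x y" and v: "v \<in> Hom T x y" and eq: "on_arr S u = on_arr S v"
  shows "u = v"
proof -
  have y: "y \<in> Obj T" using Hom_Obj[OF u] by simp
  obtain \<theta>' where \<theta>': "\<theta>' \<in> Hom T (on_obj S' (on_obj S y)) y" "\<theta>' \<cdot> \<theta> y = Id T y"
    using \<theta>_inverse(2)[OF y] by blast
  have "\<theta> y \<cdot> u = \<theta> y \<cdot> v" using \<theta>_natural[OF u] \<theta>_natural[OF v] eq by simp
  then have "(\<theta>' \<cdot> \<theta> y) \<cdot> u = (\<theta>' \<cdot> \<theta> y) \<cdot> v"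
    using Comp_assoc[OF u \<theta>_inverse(1)[OF y] \<theta>'(1)] Comp_assoc[OF v \<theta>_inverse(1)[OF y] \<theta>'(1)]
    by simp
  then show ?thesis using \<theta>'(2) Id_Comp[OF u] Id_Comp[OF v] by simp
qed

text \<open>\<open>S'\<close> is only given as a functor, so zero is not pushed through it directly.
  Instead the identity of \<open>on_obj S (on_obj S' z)\<close> factors through \<open>z\<close>
  along \<open>\<zeta> z\<close> and vanishes, and faithfulness of \<open>S\<close> removes the
  suspension.\<close>

lemma S'_zero_obj:
  assumes "is_zero_obj T z"
  shows "is_zero_obj T (on_obj S' z)"
proof -
  have z: "z \<in> Obj T" "on_obj S' z \<in> Obj T" "on_obj S (on_obj S' z) \<in> Obj T"
    using assms S'_Obj S_Obj by (simp_all add: is_zero_obj_def)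
  obtain \<zeta>' where \<zeta>': "\<zeta>' \<in> Hom T z (on_obj S (on_obj S' z))"
    "\<zeta>' \<cdot> \<zeta> z = Id T (on_obj S (on_obj S' z))"
    using \<zeta>_inverse(2)[OF z(1)] by blast
  have "\<zeta>' = Zero T z (on_obj S (on_obj S' z))"
    using zero_obj_Hom(1)[OF assms z(3) \<zeta>'(1)] .
  then have "Id T (on_obj S (on_obj S' z)) = Zero T (on_obj S (on_obj S' z)) (on_obj S (on_obj S' z))"
    using \<zeta>'(2) Zero_Comp[OF \<zeta>_inverse(1)[OF z(1)] z(3)] by simp
  then have "on_arr S (Id T (on_obj S' z)) = on_arr S (Zero T (on_obj S' z) (on_obj S' z))"
    using S_Zero[OF z(2,2)] functor_S z(2) by (simp add: is_functor_def)
  then show ?thesis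
    using is_zero_objI z(2) S_faithful[OF Id_Hom[OF z(2)] Zero_Hom[OF z(2,2)]] by blast
qed

text \<open>The transpose of \<open>k\<close> under the equivalence is
  \<open>on_arr S' k \<cdot> \<theta> x\<close>, a morphism from \<open>x\<close> to
  \<open>on_obj S' y\<close>, hence zero. Inverting \<open>\<theta>\<close> and
  \<open>\<zeta>\<close> leads back to \<open>k\<close>.\<close>

lemma Hom_S_Zero:
  assumes x: "x \<in> Obj T" and k: "k \<in> Hom T (on_obj S x) y"
    and vanish: "Hom T x (on_obj S' y) = {Zero T x (on_obj S' y)}"
  shows "k = Zero T (on_obj S x) y"
proof -
  let ?Sx = "on_obj S x"
  have O: "?Sx \<in> Obj T" "y \<in> Obj T" "on_obj S' ?Sx \<in> Obj T" "on_obj S' y \<in> Obj T"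
    "on_obj S (on_obj S' ?Sx) \<in> Obj T" "on_obj S (on_obj S' y) \<in> Obj T"
    using Hom_Obj[OF k] S'_Obj S_Obj by auto
  obtain \<theta>' where \<theta>': "\<theta>' \<in> Hom T (on_obj S' ?Sx) x" "\<theta> x \<cdot> \<theta>' = Id T (on_obj S' ?Sx)"
    using \<theta>_inverse(2)[OF x] by blast
  obtain \<zeta>' where \<zeta>': "\<zeta>' \<in> Hom T ?Sx (on_obj S (on_obj S' ?Sx))" "\<zeta> ?Sx \<cdot> \<zeta>' = Id T ?Sx"
    using \<zeta>_inverse(2)[OF O(1)] by blast
  note S'k = S'_Hom[OF k] and \<theta>x = \<theta>_inverse(1)[OF x] and \<zeta>x = \<zeta>_inverse(1)[OF O(1)]
  have "on_arr S' k \<cdot> \<theta> x = Zero T x (on_obj S' y)"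
    using Comp_Hom[OF \<theta>x S'k] vanish by simp
  then have "on_arr S' k = Zero T x (on_obj S' y) \<cdot> \<theta>'"
    using Comp_assoc[OF \<theta>'(1) \<theta>x S'k] \<theta>'(2) Comp_Id[OF S'k] by simp
  then have "on_arr S' k = Zero T (on_obj S' ?Sx) (on_obj S' y)"
    using Zero_Comp[OF \<theta>'(1) O(4)] by simp
  \<comment> \<open>Naturality of \<open>\<zeta>\<close> brings in \<open>S\<close> applied to
    \<open>on_arr S' k\<close>, and additivity of \<open>S\<close> keeps it zero.\<close>
  then have "k \<cdot> \<zeta> ?Sx = Zero T (on_obj S (on_obj S' ?Sx)) y"
    using \<zeta>_natural[OF k] S_Zero[OF O(3,4)] Comp_Zero[OF \<zeta>_inverse(1)[OF O(2)] O(5)] by simp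
  then have "k = Zero T (on_obj S (on_obj S' ?Sx)) y \<cdot> \<zeta>'"
    using Comp_assoc[OF \<zeta>'(1) \<zeta>x k] \<zeta>'(2) Comp_Id[OF k] by simp
  then show ?thesis using Zero_Comp[OF \<zeta>'(1) O(2)] by simp
qed

section \<open>Inclusion of \<open>A\<close> in the two star subcategories\<close>

lemma iso_closure_image: "x \<in> X \<Longrightarrow> F x \<in> Obj T \<Longrightarrow> F x \<in> iso_closure T (F ` X)"
  using Id_Hom[of "F x"] Id_Comp[OF Id_Hom, of "F x"]
  by (auto simp: iso_closure_def isomorphic_def is_iso_def Hom_def intro!: bexI[of _ "Id T (F x)"])

text \<open>An object of \<open>A\<close> is the middle of its identity triangle, whose third term
  is chosen as \<open>on_obj S z\<close> so that it is zero and also lies in the shifted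
  subcategory.\<close>

lemma subset_star_shift:
  assumes A: "A \<subseteq> Obj T" and z: "z \<in> A" "is_zero_obj T z"
  shows "A \<subseteq> star T \<Delta> A (shift_subcat T S A)"
proof
  fix x assume "x \<in> A"
  then have x: "x \<in> A" "x \<in> Obj T" using A by auto
  have Sz: "on_obj S z \<in> Obj T" using z A S_Obj by auto
  have "on_obj S z \<in> shift_subcat T S A"
    unfolding shift_subcat_def using iso_closure_image z(1) Sz by metis
  then show "x \<in> star T \<Delta> A (shift_subcat T S A)"
    unfolding star_def
    using x TR1_identity[OF x(2) S_zero_obj[OF z(2)]] HomD[OF Id_Hom[OF x(2)]]
      HomD[OF Zero_Hom[OF x(2) Sz]] by fastforce
qed

text \<open>Here the identity is the second morphism of the triangle and the zero first term is
  \<open>on_obj S' z\<close>.\<close>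

lemma subset_shift_star:
  assumes A: "A \<subseteq> Obj T" and z: "z \<in> A" "is_zero_obj T z"
  shows "A \<subseteq> star T \<Delta> (shift_subcat T S' A) A"
proof
  fix x assume "x \<in> A"
  then have x: "x \<in> A" "x \<in> Obj T" using A by auto
  have S'z: "on_obj S' z \<in> Obj T" using z A S'_Obj by auto
  have "on_obj S' z \<in> shift_subcat T S' A"
    unfolding shift_subcat_def using iso_closure_image z(1) S'z by metis
  then show "x \<in> star T \<Delta> (shift_subcat T S' A) A"
    unfolding star_def
    using x distinguished_zero_Id[OF x(2) S'_zero_obj[OF z(2)]] HomD[OF Id_Hom[OF x(2)]]
      HomD[OF Zero_Hom[OF S'z x(2)]] by fastforce
qed

section \<open>Universal properties of \<open>\<eta>\<close> and \<open>\<epsilon>\<close>\<close>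

lemma cokernel_reflection:
  assumes A: "A \<subseteq> Obj T" and t: "(f, p, q) \<in> \<Delta>"
    and f: "f \<in> Hom T a b" "a \<in> A" "b \<in> A" and p: "p \<in> Hom T b z"
    and vanish: "Hom T a (on_obj S' x) = {Zero T a (on_obj S' x)}"
    and coker: "is_cokernel (full_sub T A) f e" and \<eta>: "\<eta> \<in> Hom T z (Cod T e)" "\<eta> \<cdot> p = e"
    and x: "x \<in> A" and h: "h \<in> Hom T z x"
  shows "\<exists>!u. u \<in> Hom T (Cod T e) x \<and> u \<cdot> \<eta> = h"
proof -
  have e: "Cod T e \<in> A" using coker by (auto simp: is_cokernel_def full_sub_def)
  have H: "Dom T f = a" "Cod T f = b" "Cod T p = z" "Dom T p = b" using HomD f p by metis+
  have O: "a \<in> Obj T" "b \<in> Obj T" "x \<in> Obj T" "z \<in> Obj T" using A f x Hom_Obj[OF p] by auto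
  note hp = Comp_Hom[OF p h]
  have "(h \<cdot> p) \<cdot> f = Zero T a x"
    using Comp_assoc[OF f(1) p h] distinguished_Comp_Zero[OF t] H Comp_Zero[OF h O(1)] by simp
  \<comment> \<open>The cokernel is universal only within the full subcategory, so
    \<open>x \<in> A\<close> enters here.\<close>
  then have u: "\<exists>!u. u \<in> Hom T (Cod T e) x \<and> u \<cdot> e = h \<cdot> p"
    using coker hp f(2,3) x e H unfolding is_cokernel_def by simp
  have p_epi: "w = Zero T z x" if w: "w \<in> Hom T z x" "w \<cdot> p = Zero T b x" for w
  proof -
    \<comment> \<open>After rotation \<open>q\<close> is a weak cokernel of \<open>p\<close>, so
      \<open>w\<close> factors through the suspension of \<open>a\<close>.\<close>
    obtain l where l: "l \<in> Hom T (Cod T q) x" "l \<cdot> q = w"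
      using distinguished_weak_cokernel[OF distinguished_rotate[OF t]] w H by auto
    have q: "q \<in> Hom T z (on_obj S a)" using distinguished_Hom(3)[OF t] H by simp
    then have "l = Zero T (on_obj S a) x" using l(1) HomD[OF q] Hom_S_Zero[OF O(1) _ vanish] by simp
    then show ?thesis using l(2) Zero_Comp[OF q O(3)] by simp
  qed
  have "u \<cdot> \<eta> = h \<longleftrightarrow> u \<cdot> e = h \<cdot> p" if u: "u \<in> Hom T (Cod T e) x" for u
  proof -
    have "(u \<cdot> \<eta>) \<cdot> p = u \<cdot> e" using Comp_assoc[OF p \<eta>(1) u] \<eta>(2) by simp
    then show ?thesis
      using eq_if_Comp_eq_right[OF p p_epi Comp_Hom[OF \<eta>(1) u] h] by auto
  qed
  with u show ?thesis by blast
qed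

text \<open>Cancelling \<open>r\<close> on the left identifies factorisations of \<open>h\<close>
  through \<open>\<epsilon>\<close> with those of \<open>r \<cdot> h\<close> through the kernel
  \<open>e\<close>. Unlike in the cokernel case, the cancellation is proved after suspension and
  brought back by \<open>S_faithful\<close>.\<close>

lemma kernel_coreflection:
  assumes A: "A \<subseteq> Obj T" and t: "desuspended_distinguished T S S' \<zeta> \<Delta> d i r g"
    and i: "i \<in> Hom T (on_obj S' d) z" and r: "r \<in> Hom T z c"
    and g: "g \<in> Hom T c d" "c \<in> A" "d \<in> A"
    and vanish: "Hom T x (on_obj S' d) = {Zero T x (on_obj S' d)}"
    and ker: "is_kernel (full_sub T A) g e" and \<epsilon>: "\<epsilon> \<in> Hom T (Dom T e) z" "r \<cdot> \<epsilon> = e"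
    and x: "x \<in> A" and h: "h \<in> Hom T x z"
  shows "\<exists>!u. u \<in> Hom T x (Dom T e) \<and> \<epsilon> \<cdot> u = h"
proof -
  have e: "Dom T e \<in> A" using ker by (auto simp: is_kernel_def full_sub_def)
  have H: "Dom T g = c" "Cod T g = d" "Cod T i = z" "Dom T i = on_obj S' d" "Cod T r = c" "Dom T r = z"
    using HomD g i r by metis+
  have O: "c \<in> Obj T" "d \<in> Obj T" "x \<in> Obj T" "z \<in> Obj T" "on_obj S x \<in> Obj T"
    "on_obj S' d \<in> Obj T" "on_obj S (on_obj S' d) \<in> Obj T"
    using A g x Hom_Obj[OF r] S_Obj S'_Obj by auto
  \<comment> \<open>\<open>k\<close> is \<open>g\<close> before its target is identified with
    \<open>d\<close> along \<open>\<zeta> d\<close>; with it the triangle is distinguished in the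
    plain sense.\<close>
  obtain k where k: "k \<in> Hom T c (on_obj S (on_obj S' d))" "(i, r, k) \<in> \<Delta>" "g = \<zeta> d \<cdot> k"
    using t H by (auto simp: desuspended_distinguished_def)
  note rh = Comp_Hom[OF h r] and \<zeta>d = \<zeta>_inverse(1)[OF O(2)]
  have "k \<cdot> r = Zero T z (on_obj S (on_obj S' d))"
    using distinguished_Comp_Zero[OF distinguished_rotate[OF k(2)]] H HomD[OF k(1)] by simp
  then have "g \<cdot> r = Zero T z d"
    using k(3) Comp_assoc[OF r k(1) \<zeta>d] Comp_Zero[OF \<zeta>d O(4)] by simp
  then have "g \<cdot> (r \<cdot> h) = Zero T x d"
    using Comp_assoc[OF h r g(1)] Zero_Comp[OF h O(2)] by simp
  then have u: "\<exists>!u. u \<in> Hom T x (Dom T e) \<and> e \<cdot> u = r \<cdot> h"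
    using ker rh g(2,3) x e H unfolding is_kernel_def by simp
  have r_mono: "w = Zero T x z" if w: "w \<in> Hom T x z" "r \<cdot> w = Zero T x c" for w
  proof -
    obtain l where l: "l \<in> Hom T (on_obj S x) (on_obj S (on_obj S' d))"
      "on_arr S w \<cdot> Neg T (on_arr S (Id T x)) = Neg T (on_arr S i) \<cdot> l"
      using distinguished_weak_kernel_S[OF k(2)] w H by auto
    obtain \<zeta>' where \<zeta>': "\<zeta>' \<in> Hom T d (on_obj S (on_obj S' d))"
      "\<zeta>' \<cdot> \<zeta> d = Id T (on_obj S (on_obj S' d))"
      using \<zeta>_inverse(2)[OF O(2)] by blast
    \<comment> \<open>Composition with \<open>\<zeta> d\<close> gives a morphism from
      \<open>on_obj S x\<close> to \<open>d\<close>, as \<open>Hom_S_Zero\<close> requires;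
      \<open>\<zeta>'\<close> then cancels \<open>\<zeta> d\<close>.\<close>
    have "\<zeta> d \<cdot> l = Zero T (on_obj S x) d"
      using Hom_S_Zero[OF O(3) Comp_Hom[OF l(1) \<zeta>d] vanish] .
    then have "l = Zero T (on_obj S x) (on_obj S (on_obj S' d))"
      using Comp_assoc[OF l(1) \<zeta>d \<zeta>'(1)] \<zeta>'(2) Id_Comp[OF l(1)] Comp_Zero[OF \<zeta>'(1) O(5)] by simp
    note Sw = S_Hom[OF w(1)] and SI = S_Hom[OF Id_Hom[OF O(3)]]
    have N: "Neg T (on_arr S i) \<in> Hom T (on_obj S (on_obj S' d)) (on_obj S z)"
      using Neg_right S_Hom i by blast
    have Sz: "on_obj S z \<in> Obj T" using S_Obj O(4) .
    have eq: "on_arr S w \<cdot> Neg T (on_arr S (Id T x)) = Zero T (on_obj S x) (on_obj S z)"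
      using l(2) \<open>l = _\<close> Comp_Zero[OF N O(5)] by simp
    \<comment> \<open>By \<open>eq\<close> the summand coming from the negative of the identity is
      zero. Adding it turns \<open>on_arr S w\<close> into a composite with the sum of the identity
      and its negative.\<close>
    have "on_arr S w = on_arr S w \<cdot> on_arr S (Id T x)"
      using functor_S O(3) Comp_Id[OF Sw] by (simp add: is_functor_def)
    also have "\<dots> = on_arr S w \<cdot> on_arr S (Id T x) \<oplus> Zero T (on_obj S x) (on_obj S z)"
      using Zero_Add[OF Comp_Hom[OF SI Sw]] Add_comm Comp_Hom[OF SI Sw] Zero_Hom[OF O(5) Sz] by metis
    also have "\<dots> = on_arr S w \<cdot> (on_arr S (Id T x) \<oplus> Neg T (on_arr S (Id T x)))"
      using eq Comp_Add_right[OF SI conjunct1[OF Neg_right[OF SI]] Sw] by simp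
    also have "\<dots> = on_arr S (Zero T x z)"
      using Neg_right[OF SI] Comp_Zero[OF Sw O(5)] S_Zero[OF O(3,4)] by simp
    finally show ?thesis using S_faithful w(1) Zero_Hom[OF O(3,4)] by blast
  qed
  have "\<epsilon> \<cdot> u = h \<longleftrightarrow> e \<cdot> u = r \<cdot> h" if u: "u \<in> Hom T x (Dom T e)" for u
  proof -
    have "r \<cdot> (\<epsilon> \<cdot> u) = e \<cdot> u" using Comp_assoc[OF u \<epsilon>(1) r] \<epsilon>(2) by simp
    then show ?thesis
      using eq_if_Comp_eq_left[OF r r_mono Comp_Hom[OF u \<epsilon>(1)] h] by auto
  qed
  with u show ?thesis by blast
qed

end

section \<open>Assembly of the two adjunctions\<close>

theorem corollary1p15:
  fixes T :: "('o, 'm, 'x) addcat_scheme"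
    and S S' :: "('o, 'm, 'o, 'm) functor_data"
    and \<zeta> \<theta> :: "'o \<Rightarrow> 'm"
    and \<Delta> :: "('m \<times> 'm \<times> 'm) set"
    and A :: "'o set"
    and ker coker :: "'m \<Rightarrow> 'm"
    and a b c d :: "'o \<Rightarrow> 'o"
    and f p q i r g :: "'o \<Rightarrow> 'm"
    and \<eta> \<epsilon> :: "'o \<Rightarrow> 'm"
  defines "ASA \<equiv> star T \<Delta> A (shift_subcat T S A)"
    and "S'AA \<equiv> star T \<Delta> (shift_subcat T S' A) A"
  assumes triangulated: "triangulated_category T S \<Delta>"
    and desuspension: "quasi_inverse T S S' \<zeta> \<theta>"
    and abelian: "abelian_subcategory T A"
    and vanishing: "\<And>x y. x \<in> A \<Longrightarrow> y \<in> A \<Longrightarrow> Hom T x (on_obj S' y) = {Zero T x (on_obj S' y)}"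
    and kernels: "\<And>u. u \<in> Arr (full_sub T A) \<Longrightarrow> is_kernel (full_sub T A) u (ker u)"
    and cokernels: "\<And>u. u \<in> Arr (full_sub T A) \<Longrightarrow> is_cokernel (full_sub T A) u (coker u)"
    and triangles_ASA: "\<And>z. z \<in> ASA \<Longrightarrow> a z \<in> A \<and> b z \<in> A \<and>
      f z \<in> Hom T (a z) (b z) \<and> p z \<in> Hom T (b z) z \<and> q z \<in> Hom T z (on_obj S (a z)) \<and>
      (f z, p z, q z) \<in> \<Delta>"
    and triangles_S'AA: "\<And>x. x \<in> S'AA \<Longrightarrow> c x \<in> A \<and> d x \<in> A \<and>
      i x \<in> Hom T (on_obj S' (d x)) x \<and> r x \<in> Hom T x (c x) \<and> g x \<in> Hom T (c x) (d x) \<and>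
      desuspended_distinguished T S S' \<zeta> \<Delta> (d x) (i x) (r x) (g x)"
    and eta: "\<And>z. z \<in> ASA \<Longrightarrow> \<eta> z \<in> Hom T z (Cod T (coker (f z))) \<and>
      \<eta> z \<cdot>\<^bsub>T\<^esub> p z = coker (f z)"
    and epsilon: "\<And>x. x \<in> S'AA \<Longrightarrow> \<epsilon> x \<in> Hom T (Dom T (ker (g x))) x \<and>
      r x \<cdot>\<^bsub>T\<^esub> \<epsilon> x = ker (g x)"
  shows "left_adjoint_with_unit (full_sub T ASA) (full_sub T A) (C_functor T coker f \<eta>) incl \<eta>
    \<and> right_adjoint_with_counit (full_sub T A) (full_sub T S'AA) incl (K_functor T ker g \<epsilon>) \<epsilon>"
proof -
  interpret desuspended_category T S \<Delta> S' \<zeta> \<theta>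
    using triangulated desuspension
    by (simp add: desuspended_category_def desuspended_category_axioms_def)
  have A: "A \<subseteq> Obj T"
    using abelian by (simp add: abelian_subcategory_def additive_subcategory_def iso_closed_def)
  interpret sub: additive_category "full_sub T A"
    using abelian by (simp add: abelian_subcategory_def additive_subcategory_def)
  obtain z0 where z0: "is_zero_obj (full_sub T A) z0" using sub.ex_zero_obj by blast
  then have z0A: "z0 \<in> A" by (simp add: is_zero_obj_def)
  \<comment> \<open>The subcategory shares identities and zero morphisms with \<open>T\<close>, so
    vanishing of the identity carries its zero object over to \<open>T\<close>.\<close>
  have "Id T z0 = Zero T z0 z0"
    using sub.zero_obj_Hom(1)[OF z0, of z0 "Id T z0"] sub.Id_Hom[of z0] z0A by simp
  then have z0T: "is_zero_obj T z0" using is_zero_objI z0A A by blast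
  have sub_ASA: "A \<subseteq> ASA" "ASA \<subseteq> Obj T"
    unfolding ASA_def using subset_star_shift[OF A z0A z0T] by (auto simp: star_def)
  have sub_S'AA: "A \<subseteq> S'AA" "S'AA \<subseteq> Obj T"
    unfolding S'AA_def using subset_shift_star[OF A z0A z0T] by (auto simp: star_def)
  have C: "is_cokernel (full_sub T A) (f z) (coker (f z))" if "z \<in> ASA" for z
    using triangles_ASA[OF that] by (intro cokernels Arr_full_sub[of _ _ "a z" "b z"]) simp_all
  have K: "is_kernel (full_sub T A) (g z) (ker (g z))" if "z \<in> S'AA" for z
    using triangles_S'AA[OF that] by (intro kernels Arr_full_sub[of _ _ "c z" "d z"]) simp_all
  have "left_adjoint_with_unit (full_sub T ASA) (full_sub T A) (C_functor T coker f \<eta>) incl \<eta>"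
    unfolding C_functor_def
  proof (rule reflection_left_adjoint[OF sub_ASA])
    fix z assume z: "z \<in> ASA"
    show "Cod T (coker (f z)) \<in> A" using C[OF z] by (auto simp: is_cokernel_def full_sub_def)
    show "\<eta> z \<in> Hom T z (Cod T (coker (f z)))" using eta[OF z] by simp
    fix x h assume "x \<in> A" "h \<in> Hom T z x"
    then show "\<exists>!u. u \<in> Hom T (Cod T (coker (f z))) x \<and> u \<cdot>\<^bsub>T\<^esub> \<eta> z = h"
      using triangles_ASA[OF z] eta[OF z]
      by (intro cokernel_reflection[OF A, of "f z" "p z" "q z" "a z" "b z"] C z vanishing) simp_all
  qed
  moreover have
    "right_adjoint_with_counit (full_sub T A) (full_sub T S'AA) incl (K_functor T ker g \<epsilon>) \<epsilon>"
    unfolding K_functor_def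
  proof (rule coreflection_right_adjoint[OF sub_S'AA])
    fix z assume z: "z \<in> S'AA"
    show "Dom T (ker (g z)) \<in> A" using K[OF z] by (auto simp: is_kernel_def full_sub_def)
    show "\<epsilon> z \<in> Hom T (Dom T (ker (g z))) z" using epsilon[OF z] by simp
    fix x h assume "x \<in> A" "h \<in> Hom T x z"
    then show "\<exists>!u. u \<in> Hom T x (Dom T (ker (g z))) \<and> \<epsilon> z \<cdot>\<^bsub>T\<^esub> u = h"
      using triangles_S'AA[OF z] epsilon[OF z]
      by (intro kernel_coreflection[OF A, of "d z" "i z" "r z" "g z" _ "c z"] K z vanishing) simp_all
  qed
  ultimately show ?thesis ..
qed

end
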